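(* Let $\mathrm{B}_h$, $\mathrm{B}_H$ be the nonsingular fine- and coarse-grid stage-coupled matrices, $\mathrm{P}=I_s\otimes P$, $\mathrm{R}=I_s\otimes R$, and let $\mathrm{W}$ be a nonsingular $sN\times sN$ matrix that is monolithic with respect to $\mathrm{X}_h = X\otimes I_N$, i.e. $\mathrm{W}=\mathrm{X}_h\,\mathrm{diag}_{1\le i\le s}(W_i)\,\mathrm{X}_h^{-1}$ with $W_i\in\mathbb{C}^{N\times N}$. Let $\nu\geq 0$ be an integer, $\mathrm{S}=\mathrm{I}-\mathrm{W}^{-1}\mathrm{B}_h$, and let $$\mathrm{T} = \left(\mathrm{I}-\mathrm{P}\,\mathrm{B}_H^{-1}\,\mathrm{R}\,\mathrm{B}_h\right)\mathrm{S}^\nu$$ be the stage-coupled two-grid iteration matrix. For $1\le i\le s$ let $$S_i = I - W_i^{-1}B_{h,\lambda_i\Delta t},\qquad T_i=\left(I-P\,B_{H,\lambda_i\Delta t}^{-1}\,R\,B_{h,\lambda_i\Delta t}\right)S_i^\nu .$$ Then $$\rho(\mathrm{T})=\max_{1\le i\le s}\rho(T_i),$$ where $\rho$ denotes the spectral radius. Consequently, the stage-coupled two-grid iteration (with iteration matrix $\mathrm{T}$ for systems with matrix $\mathrm{B}_h$) converges if and only if, for every $1\le i\le s$, the single-stage two-grid iteration (with iteration matrix $T_i$ for systems with matrix $B_{h,\lambda_i\Delta t}$) converges.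
   Context: Setting. $V$ is a real Hilbert space (compactly embedded in another Hilbert space), $m$ and $a$ are bilinear forms on $V$ with $a$ bounded. $V_H\subset V_h\subset V$ are finite-dimensional subspaces with bases; $N=\dim V_h$, $n=\dim V_H$. If $\{\phi_i\}$ is the basis of $V_h$, then $M_h,K_h\in\mathbb{R}^{N\times N}$ have entries $(M_h)_{ij}=m(\phi_j,\phi_i)$, $(K_h)_{ij}=a(\phi_j,\phi_i)$; $M_H,K_H\in\mathbb{R}^{n\times n}$ are defined likewise on $V_H$. $P\in\mathbb{R}^{N\times n}$ is the matrix of the inclusion $V_H\to V_h$ (prolongation) and $R\in\mathbb{R}^{n\times N}$ is a restriction matrix (frequently $P^T$, but this is not required). $A\in\mathbb{R}^{s\times s}$ is the Butcher matrix of an $s$-stage Runge-Kutta method, $\Delta t>0$, and it is assumed that $A$ is diagonalizable: $A=X\Lambda X^{-1}$ with $X\in\mathbb{C}^{s\times s}$ invertible and $\Lambda=\mathrm{diag}(\lambda_1,\dots,\lambda_s)$. The stage-coupled matrices are $\mathrm{B}_h=I_s\otimes M_h+\Delta t\,A\otimes K_h$ and $\mathrm{B}_H=I_s\otimes M_H+\Delta t\,A\otimes K_H$ ($\otimes$ is the Kronecker product), both assumed nonsingular. For $z\in\mathbb{C}$, $B_{h,z}=M_h+zK_h$ and $B_{H,z}=M_H+zK_H$. Definition (monolithic). An $sN\times sN$ matrix $\mathrm{Y}$ is monolithic with respect to $\mathrm{X}=X\otimes I_N$ if there exist $N\times N$ (complex) matrices $Y_1,\dots,Y_s$ with $\mathrm{X}^{-1}\mathrm{Y}\mathrm{X}=\mathrm{diag}_{1\le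 i\le s}Y_i$ (block diagonal). Convergence. For a nonsingular matrix $C$, the iteration with iteration matrix $T$ for the system $Cx=b$ is $x^{(k+1)}=Tx^{(k)}+\tilde g$ with $\tilde g=(I-T)C^{-1}b$, so that the solution is a fixed point and the error satisfies $e^{(k+1)}=Te^{(k)}$. It converges if for every right-hand side $b$ and every initial vector $x^{(0)}$ (complex vectors) the iterates tend to $C^{-1}b$. *)

theory Defs
  imports "HOL-Analysis.Linear_Algebra" "HOL-Analysis.Elementary_Normed_Spaces"
    "Jordan_Normal_Form.Spectral_Radius"
begin

definition compact_embedding ::
    "('v::real_normed_vector \<Rightarrow> 'w::real_normed_vector) \<Rightarrow> bool" where
  "compact_embedding J \<longleftrightarrow>
     bounded_linear J \<and> inj J \<and> (\<forall>B. bounded B \<longrightarrow> compact (closure (J ` B)))"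

text \<open>Ordered bases of finite-dimensional subspaces are families indexed by \<open>0, \<dots>, N - 1\<close>;
  the subspace then has dimension \<open>N\<close>.\<close>

definition basis_family :: "nat \<Rightarrow> (nat \<Rightarrow> 'v::real_vector) \<Rightarrow> 'v set \<Rightarrow> bool" where
  "basis_family N \<phi> U \<longleftrightarrow>
     inj_on \<phi> {..<N} \<and> independent (\<phi> ` {..<N}) \<and> span (\<phi> ` {..<N}) = U"

text \<open>Note the transposed arguments: the trial function is the first argument of the form.\<close>

definition form_mat :: "('v \<Rightarrow> 'v \<Rightarrow> real) \<Rightarrow> nat \<Rightarrow> (nat \<Rightarrow> 'v) \<Rightarrow> real mat" where
  "form_mat f N \<phi> = mat N N (\<lambda>(i, j). f (\<phi> j) (\<phi> i))"

text \<open>\<open>P\<close> is the matrix, with respect to the bases \<open>\<psi>\<close> (domain, \<open>n\<close> elements) and \<open>\<phi>\<close>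
  (codomain, \<open>N\<close> elements), of the inclusion of the span of \<open>\<psi>\<close> into the span of \<open>\<phi>\<close>.\<close>

definition inclusion_mat ::
    "real mat \<Rightarrow> nat \<Rightarrow> (nat \<Rightarrow> 'v::real_vector) \<Rightarrow> nat \<Rightarrow> (nat \<Rightarrow> 'v) \<Rightarrow> bool" where
  "inclusion_mat P N \<phi> n \<psi> \<longleftrightarrow>
     P \<in> carrier_mat N n \<and> (\<forall>j<n. \<psi> j = (\<Sum>i<N. (P $$ (i, j)) *\<^sub>R \<phi> i))"

definition cmat :: "real mat \<Rightarrow> complex mat" where
  "cmat A = map_mat complex_of_real A"

text \<open>The inverse is meaningful for invertible square matrices only; otherwise it is the
  unspecified value \<open>the None\<close>.\<close>

definition mat_inv :: "'a::field mat \<Rightarrow> 'a mat" where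
  "mat_inv A = the (mat_inverse A)"

definition kron :: "'a::semiring_1 mat \<Rightarrow> 'a mat \<Rightarrow> 'a mat" where
  "kron A B = mat (dim_row A * dim_row B) (dim_col A * dim_col B)
     (\<lambda>(i, j). A $$ (i div dim_row B, j div dim_col B) * B $$ (i mod dim_row B, j mod dim_col B))"

definition stage_coupled_mat :: "real \<Rightarrow> real mat \<Rightarrow> real mat \<Rightarrow> real mat \<Rightarrow> real mat" where
  "stage_coupled_mat \<Delta>t A M K = kron (1\<^sub>m (dim_row A)) M + \<Delta>t \<cdot>\<^sub>m kron A K"

definition single_stage_mat :: "complex \<Rightarrow> real mat \<Rightarrow> real mat \<Rightarrow> complex mat" where
  "single_stage_mat z M K = cmat M + z \<cdot>\<^sub>m cmat K"

definition block_diag :: "nat \<Rightarrow> (nat \<Rightarrow> 'a::zero mat) \<Rightarrow> 'a mat" where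
  "block_diag s Y = diag_block_mat (map Y [0..<s])"

definition monolithic :: "nat \<Rightarrow> nat \<Rightarrow> complex mat \<Rightarrow> complex mat \<Rightarrow> bool" where
  "monolithic s N X Y \<longleftrightarrow> Y \<in> carrier_mat (s * N) (s * N) \<and>
     (\<exists>Ys. (\<forall>i<s. Ys i \<in> carrier_mat N N) \<and> mat_inv X * Y * X = block_diag s Ys)"

definition smoother_mat :: "complex mat \<Rightarrow> complex mat \<Rightarrow> complex mat" where
  "smoother_mat W B = 1\<^sub>m (dim_row B) - mat_inv W * B"

text \<open>Arguments: prolongation, restriction, coarse- and fine-grid matrix, preconditioner
  defining the smoother, and number of smoothing steps.\<close>

definition two_grid_mat ::
    "complex mat \<Rightarrow> complex mat \<Rightarrow> complex mat \<Rightarrow> complex mat \<Rightarrow> complex mat \<Rightarrow> nat \<Rightarrow> complex mat"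
  where
  "two_grid_mat P R BH Bh W \<nu> =
     (1\<^sub>m (dim_row Bh) - P * mat_inv BH * R * Bh) * (smoother_mat W Bh ^\<^sub>m \<nu>)"

definition iteration ::
    "complex mat \<Rightarrow> complex mat \<Rightarrow> complex vec \<Rightarrow> complex vec \<Rightarrow> nat \<Rightarrow> complex vec" where
  "iteration T C b x0 k =
     ((\<lambda>x. T *\<^sub>v x + (1\<^sub>m (dim_row C) - T) *\<^sub>v (mat_inv C *\<^sub>v b)) ^^ k) x0"

text \<open>Vectors of dynamic dimension carry no topology; convergence is convergence of each entry.\<close>

definition vec_tendsto :: "(nat \<Rightarrow> complex vec) \<Rightarrow> complex vec \<Rightarrow> bool" where
  "vec_tendsto x l \<longleftrightarrow> (\<forall>i<dim_vec l. (\<lambda>k. vec_index (x k) i) \<longlonglongrightarrow> vec_index l i)"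

definition iteration_converges :: "complex mat \<Rightarrow> complex mat \<Rightarrow> bool" where
  "iteration_converges T C \<longleftrightarrow>
     (\<forall>b \<in> carrier_vec (dim_row C). \<forall>x0 \<in> carrier_vec (dim_row C).
        vec_tendsto (iteration T C b x0) (mat_inv C *\<^sub>v b))"

end

(* The matrix Xh = kron X 1, together with its coarse analogue kron X 1 of size s * n, intertwines
   every factor of T with a block diagonal matrix: for the prolongation, the restriction and the
   coupled matrices this is the mixed-product rule for kron, for W it is monolithicity. Hence
   T * Xh = Xh * diag (T_1, ..., T_s). The single-stage matrices and the W_i are nonsingular
   because a block diagonal matrix is invertible iff its blocks are; the same fact applied to
   T - e gives the spectrum. The k-th error is T^k e_0, so convergence means that the entries of
   T^k tend to 0, which is invariant under similarity and can be tested on the blocks. *)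
theory Submission
  imports Defs
begin

text \<open>Prolongation and restriction change the size, so a single conjugation cannot be pushed
  through the coarse-grid correction. The working relation is \<open>A * Y = X * B\<close>, with a
  possibly different square matrix on each side. It composes along products and passes to
  differences from the identity, powers and inverses, so the two-grid matrix can be treated in the
  order in which it is built. A second obstacle is that \<open>mat_inv\<close> says something only
  about invertible matrices. Nonsingularity is given for the coupled matrices and for
  \<open>W\<close>, and has to be brought down to the single stages before any stage inverse can be
  handled. Finally, the grid matrices and \<open>A\<close> are real while the eigenvectors of
  \<open>A\<close> may be complex, so the coupled matrices are complexified before they are
  diagonalized.\<close>

section \<open>Flat indices \<open>k * r + i\<close> of blocked matrices\<close>

lemma block_index_less_iff:
  fixes i r k s :: nat
  assumes "i < r"
  shows "k * r + i < s * r \<longleftrightarrow> k < s"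
proof -
  have "k * r + i < s * r \<longleftrightarrow> (k * r + i) div r < s"
    using assms by (intro div_less_iff_less_mult[symmetric]) simp
  then show ?thesis using assms by simp
qed

lemma block_index_eq_iff:
  fixes i j r k l :: nat
  assumes "i < r" "j < r"
  shows "k * r + i = l * r + j \<longleftrightarrow> k = l \<and> i = j"
proof
  assume eq: "k * r + i = l * r + j"
  have "(k * r + i) div r = k" "(l * r + j) div r = l" using assms by simp_all
  then have "k = l" by (simp only: eq)
  then show "k = l \<and> i = j" using eq by simp
qed simp

lemma block_indexE:
  fixes i s r :: nat
  assumes "i < s * r"
  obtains k j where "k < s" "j < r" "i = k * r + j"
proof
  show "i div r < s" using assms by (rule less_mult_imp_div_less)
  show "i mod r < r" using assms by (cases r) simp_all
qed simp

lemma sum_blocks: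
  fixes f :: "nat \<Rightarrow> 'a::comm_monoid_add"
  shows "(\<Sum>j<s * c. f j) = (\<Sum>k<s. \<Sum>l<c. f (k * c + l))"
  by (subst sum.nat_group[symmetric])
    (simp add: sum.atLeastLessThan_shift_0[of _ "_ * _"] atLeast0LessThan)

text \<open>Extensionality in the coordinates (block, offset): once indices have the form
  \<open>k * r + i\<close> with \<open>i < r\<close>, the \<open>div\<close> and \<open>mod\<close>
  in the definitions simplify away. The numbers of block rows and block columns may differ, as a
  general Kronecker product requires.\<close>

lemma eq_mat_blockI:
  assumes A: "A \<in> carrier_mat (s * r) (t * c)" and B: "B \<in> carrier_mat (s * r) (t * c)"
    and eq: "\<And>k l i j. k < s \<Longrightarrow> l < t \<Longrightarrow> i < r \<Longrightarrow> j < c \<Longrightarrow>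
      A $$ (k * r + i, l * c + j) = B $$ (k * r + i, l * c + j)"
  shows "A = B"
proof (rule eq_matI)
  fix i j assume "i < dim_row B" "j < dim_col B"
  then have "i < s * r" "j < t * c" using B by auto
  then show "A $$ (i, j) = B $$ (i, j)" by (elim block_indexE) (simp add: eq)
qed (use A B in auto)

lemma index_mult_mat_sum:
  assumes "A \<in> carrier_mat m n" "B \<in> carrier_mat n p" "i < m" "j < p"
  shows "(A * B) $$ (i, j) = (\<Sum>k<n. A $$ (i, k) * B $$ (k, j))"
  using assms by (simp add: scalar_prod_def atLeast0LessThan)

section \<open>The Kronecker product\<close>

lemma kron_carrier [simp]:
  assumes "A \<in> carrier_mat a b" "B \<in> carrier_mat c d"
  shows "kron A B \<in> carrier_mat (a * c) (b * d)"
  using assms by (auto simp: kron_def)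

lemma kron_index_block:
  assumes "A \<in> carrier_mat a b" "B \<in> carrier_mat c d" "k < a" "l < b" "i < c" "j < d"
  shows "kron A B $$ (k * c + i, l * d + j) = A $$ (k, l) * B $$ (i, j)"
  using assms by (simp add: kron_def block_index_less_iff)

text \<open>Splitting the summation index into block and offset gives a double sum whose terms
  separate into a factor depending on \<open>u\<close> and a factor depending on \<open>v\<close>.
  Commutativity of the scalars is what allows the entries of \<open>B\<close> and \<open>C\<close>
  to change places.\<close>

lemma kron_mult:
  fixes A :: "'a::comm_semiring_1 mat"
  assumes A: "A \<in> carrier_mat a b" and B: "B \<in> carrier_mat p q"
    and C: "C \<in> carrier_mat b c" and D: "D \<in> carrier_mat q r"
  shows "kron A B * kron C D = kron (A * C) (B * D)"
proof (rule eq_mat_blockI)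
  note AC = mult_carrier_mat[OF A C] and BD = mult_carrier_mat[OF B D]
  note AB' = kron_carrier[OF A B] and CD' = kron_carrier[OF C D]
  show "kron A B * kron C D \<in> carrier_mat (a * p) (c * r)" by (rule mult_carrier_mat[OF AB' CD'])
  show "kron (A * C) (B * D) \<in> carrier_mat (a * p) (c * r)" by (rule kron_carrier[OF AC BD])
  fix k l i j assume kl: "k < a" "l < c" and ij: "i < p" "j < r"
  have "(kron A B * kron C D) $$ (k * p + i, l * r + j)
      = (\<Sum>u<b. \<Sum>v<q. kron A B $$ (k * p + i, u * q + v) * kron C D $$ (u * q + v, l * r + j))"
    using kl ij by (subst index_mult_mat_sum[OF AB' CD']) (simp_all add: block_index_less_iff sum_blocks)
  also have "\<dots> = (\<Sum>u<b. \<Sum>v<q. (A $$ (k, u) * C $$ (u, l)) * (B $$ (i, v) * D $$ (v, j)))"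
    using kl ij by (simp add: kron_index_block[OF A B] kron_index_block[OF C D] mult_ac)
  also have "\<dots> = (A * C) $$ (k, l) * (B * D) $$ (i, j)"
    unfolding index_mult_mat_sum[OF A C kl] index_mult_mat_sum[OF B D ij]
    by (rule sum_product[symmetric])
  also have "\<dots> = kron (A * C) (B * D) $$ (k * p + i, l * r + j)"
    by (rule kron_index_block[OF AC BD kl ij, symmetric])
  finally show "(kron A B * kron C D) $$ (k * p + i, l * r + j)
    = kron (A * C) (B * D) $$ (k * p + i, l * r + j)" .
qed

lemma kron_one: "kron (1\<^sub>m a) (1\<^sub>m b) = (1\<^sub>m (a * b) :: 'a::semiring_1 mat)"
proof (rule eq_mat_blockI)
  show "kron (1\<^sub>m a) (1\<^sub>m b) \<in> carrier_mat (a * b) (a * b)" by simp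
qed (simp_all add: kron_index_block[OF one_carrier_mat one_carrier_mat] block_index_less_iff
    block_index_eq_iff)

section \<open>Calculus of block diagonal matrices\<close>

text \<open>A closed formula for entries in the same index layout as \<open>kron\<close>, instead of
  the recursion over a list behind \<open>block_diag\<close>. The block sizes are parameters, so the
  dimensions do not depend on the family \<open>Y\<close>, and rectangular blocks accommodate
  prolongation and restriction.\<close>

definition rect_block_diag :: "nat \<Rightarrow> nat \<Rightarrow> nat \<Rightarrow> (nat \<Rightarrow> 'a::zero mat) \<Rightarrow> 'a mat" where
  "rect_block_diag s r c Y = mat (s * r) (s * c)
     (\<lambda>(i, j). if i div r = j div c then Y (i div r) $$ (i mod r, j mod c) else 0)"

lemma rect_block_diag_carrier [simp]:
  "rect_block_diag s r c Y \<in> carrier_mat (s * r) (s * c)"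
  by (simp add: rect_block_diag_def)

lemma rect_block_diag_dim [simp]:
  "dim_row (rect_block_diag s r c Y) = s * r" "dim_col (rect_block_diag s r c Y) = s * c"
  by (simp_all add: rect_block_diag_def)

lemma rect_block_diag_index:
  assumes "k < s" "l < s" "i < r" "j < c"
  shows "rect_block_diag s r c Y $$ (k * r + i, l * c + j) = (if k = l then Y k $$ (i, j) else 0)"
  using assms by (simp add: rect_block_diag_def block_index_less_iff)

lemma rect_block_diag_eqI:
  assumes "A \<in> carrier_mat (s * r) (s * c)"
    and "\<And>k l i j. k < s \<Longrightarrow> l < s \<Longrightarrow> i < r \<Longrightarrow> j < c \<Longrightarrow>
      A $$ (k * r + i, l * c + j) = (if k = l then Y k $$ (i, j) else 0)"
  shows "A = rect_block_diag s r c Y"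
  using assms(1) rect_block_diag_carrier
  by (rule eq_mat_blockI) (simp only: assms(2) rect_block_diag_index)

lemma rect_block_diag_cong:
  assumes "\<And>i. i < s \<Longrightarrow> Y i = Z i"
  shows "rect_block_diag s r c Y = rect_block_diag s r c Z"
  by (rule rect_block_diag_eqI) (simp_all add: rect_block_diag_index assms)

text \<open>The right factor is arbitrary on purpose: the formula is also applied to the inverse of
  a block diagonal matrix, before anything is known about the structure of that inverse.\<close>

lemma rect_block_diag_mult_index:
  fixes E :: "'a::semiring_1 mat"
  assumes E: "E \<in> carrier_mat (s * c) m" and k: "k < s" and i: "i < r" and j: "j < m"
  shows "(rect_block_diag s r c Y * E) $$ (k * r + i, j)
    = (\<Sum>l<c. Y k $$ (i, l) * E $$ (k * c + l, j))"
proof -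
  have "(rect_block_diag s r c Y * E) $$ (k * r + i, j)
      = (\<Sum>u<s. \<Sum>l<c. rect_block_diag s r c Y $$ (k * r + i, u * c + l) * E $$ (u * c + l, j))"
    using k i j
    by (subst index_mult_mat_sum[OF rect_block_diag_carrier E])
      (simp_all add: block_index_less_iff sum_blocks)
  also have "\<dots> = (\<Sum>u<s. if k = u then (\<Sum>l<c. Y k $$ (i, l) * E $$ (k * c + l, j)) else 0)"
    using k i by (intro sum.cong refl) (simp add: rect_block_diag_index)
  also have "\<dots> = (\<Sum>l<c. Y k $$ (i, l) * E $$ (k * c + l, j))"
    using k by simp
  finally show ?thesis .
qed

lemma rect_block_diag_mult:
  fixes Y Z :: "nat \<Rightarrow> 'a::semiring_1 mat"
  assumes Y: "\<And>i. i < s \<Longrightarrow> Y i \<in> carrier_mat r c"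
    and Z: "\<And>i. i < s \<Longrightarrow> Z i \<in> carrier_mat c d"
  shows "rect_block_diag s r c Y * rect_block_diag s c d Z = rect_block_diag s r d (\<lambda>i. Y i * Z i)"
proof (rule rect_block_diag_eqI)
  show "rect_block_diag s r c Y * rect_block_diag s c d Z \<in> carrier_mat (s * r) (s * d)"
    by (rule mult_carrier_mat[OF rect_block_diag_carrier rect_block_diag_carrier])
  fix k l i j assume kl: "k < s" "l < s" and ij: "i < r" "j < d"
  show "(rect_block_diag s r c Y * rect_block_diag s c d Z) $$ (k * r + i, l * d + j)
      = (if k = l then (Y k * Z k) $$ (i, j) else 0)"
    using kl ij
    by (simp add: rect_block_diag_mult_index[OF rect_block_diag_carrier] block_index_less_iff
        rect_block_diag_index index_mult_mat_sum[OF Y Z] del: index_mult_mat)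
qed

lemma rect_block_diag_one: "rect_block_diag s r r (\<lambda>_. 1\<^sub>m r) = (1\<^sub>m (s * r) :: 'a::semiring_1 mat)"
  by (rule rect_block_diag_eqI[symmetric]) (simp_all add: block_index_less_iff block_index_eq_iff)

lemma rect_block_diag_minus:
  fixes Y Z :: "nat \<Rightarrow> 'a::ab_group_add mat"
  assumes Y: "\<And>i. i < s \<Longrightarrow> Y i \<in> carrier_mat r c" and Z: "\<And>i. i < s \<Longrightarrow> Z i \<in> carrier_mat r c"
  shows "rect_block_diag s r c Y - rect_block_diag s r c Z = rect_block_diag s r c (\<lambda>i. Y i - Z i)"
proof (rule rect_block_diag_eqI)
  show "rect_block_diag s r c Y - rect_block_diag s r c Z \<in> carrier_mat (s * r) (s * c)"
    by (rule minus_carrier_mat[OF rect_block_diag_carrier])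
  fix k l i j assume "k < s" "l < s" "i < r" "j < c"
  then show "(rect_block_diag s r c Y - rect_block_diag s r c Z) $$ (k * r + i, l * c + j)
      = (if k = l then (Y k - Z k) $$ (i, j) else 0)"
    using carrier_matD[OF Z[of l]] by (simp add: rect_block_diag_index block_index_less_iff)
qed

lemma rect_block_diag_pow:
  fixes Y :: "nat \<Rightarrow> 'a::semiring_1 mat"
  assumes Y: "\<And>i. i < s \<Longrightarrow> Y i \<in> carrier_mat r r"
  shows "rect_block_diag s r r Y ^\<^sub>m k = rect_block_diag s r r (\<lambda>i. Y i ^\<^sub>m k)"
proof (induction k)
  case 0
  have "rect_block_diag s r r (\<lambda>i. Y i ^\<^sub>m 0) = rect_block_diag s r r (\<lambda>_. 1\<^sub>m r)"
    using Y by (intro rect_block_diag_cong) auto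
  then show ?case by (simp add: rect_block_diag_one)
next
  case (Suc k)
  then show ?case
    using rect_block_diag_mult[of s "\<lambda>i. Y i ^\<^sub>m k" r r Y r] Y by simp
qed

text \<open>Turns prolongation and restriction, which act identically on every stage, into constant
  families of blocks, so that the whole two-grid formula lives in one calculus.\<close>

lemma kron_one_left:
  assumes "B \<in> carrier_mat r c"
  shows "kron (1\<^sub>m s) B = rect_block_diag s r c (\<lambda>_. B)"
  by (rule rect_block_diag_eqI[OF kron_carrier[OF one_carrier_mat assms]])
    (simp add: kron_index_block[OF one_carrier_mat assms])

text \<open>Connects the list-based encoding to the formula for entries. The induction splits off
  the last block, because \<open>[0..<Suc s]\<close> grows at its end.\<close>

lemma block_diag_eq_rect_block_diag:
  assumes "\<And>i. i < s \<Longrightarrow> Y i \<in> carrier_mat r r"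
  shows "block_diag s Y = rect_block_diag s r r Y"
  using assms
proof (induction s)
  case 0
  show ?case by (rule rect_block_diag_eqI) (simp_all add: block_diag_def)
next
  case (Suc s)
  let ?D = "rect_block_diag s r r Y"
  have IH: "block_diag s Y = ?D" and Ys: "Y s \<in> carrier_mat r r" using Suc by auto
  have eq: "block_diag (Suc s) Y = four_block_mat ?D (0\<^sub>m (s * r) r) (0\<^sub>m r (s * r)) (Y s)"
    using carrier_matD[OF Ys] IH by (simp add: block_diag_def diag_block_mat_last Let_def)
  have "four_block_mat ?D (0\<^sub>m (s * r) r) (0\<^sub>m r (s * r)) (Y s) = rect_block_diag (Suc s) r r Y"
  proof (rule rect_block_diag_eqI)
    show "four_block_mat ?D (0\<^sub>m (s * r) r) (0\<^sub>m r (s * r)) (Y s) \<in> carrier_mat (Suc s * r) (Suc s * r)"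
      using four_block_carrier_mat[OF rect_block_diag_carrier Ys] by (simp add: add.commute)
    fix k l i j assume kl: "k < Suc s" "l < Suc s" and ij: "i < r" "j < r"
    have "k * r + i < s * r + r" "l * r + j < s * r + r"
      using kl ij block_index_less_iff[of i r k "Suc s"] block_index_less_iff[of j r l "Suc s"]
      by (simp_all add: add.commute)
    then show "four_block_mat ?D (0\<^sub>m (s * r) r) (0\<^sub>m r (s * r)) (Y s) $$ (k * r + i, l * r + j)
        = (if k = l then Y k $$ (i, j) else 0)"
      using kl ij carrier_matD[OF Ys]
      by (auto simp: block_index_less_iff rect_block_diag_index less_Suc_eq)
  qed
  then show ?case by (simp only: eq)
qed

section \<open>Inverses and invertibility of blocks\<close>

lemma invertible_mat_iff_det:
  fixes A :: "'a::field mat"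
  assumes A: "A \<in> carrier_mat n n"
  shows "invertible_mat A \<longleftrightarrow> det A \<noteq> 0"
proof
  assume "invertible_mat A"
  then obtain B where AB: "A * B = 1\<^sub>m n" and BA: "B * A = 1\<^sub>m (dim_row B)"
    using A by (auto simp: invertible_mat_def inverts_mat_def)
  \<comment> \<open>\<open>invertible_mat\<close> does not fix the size of the inverse: the first
    product determines the number of columns of \<open>B\<close>, the second its number of
    rows.\<close>
  have "dim_col (A * B) = n" "dim_col (B * A) = dim_row B" using AB BA by auto
  then have B: "B \<in> carrier_mat n n" using A by auto
  show "det A \<noteq> 0" using det_mult[OF A B] AB by auto
next
  assume "det A \<noteq> 0"
  from det_non_zero_imp_unit[OF A this, of "()"]
  obtain B where "B \<in> carrier_mat n n" "B * A = 1\<^sub>m n" "A * B = 1\<^sub>m n"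
    unfolding Units_def ring_mat_def by auto
  then show "invertible_mat A"
    using A by (auto simp: invertible_mat_def inverts_mat_def)
qed

text \<open>A nonzero determinant makes \<open>A\<close> a unit of the matrix ring, which rules out
  the result \<open>None\<close> of \<open>mat_inverse\<close>; hence \<open>the\<close> returns a
  genuine two-sided inverse.\<close>

lemma mat_inv:
  assumes A: "A \<in> carrier_mat n n" and inv: "invertible_mat A"
  shows "mat_inv A \<in> carrier_mat n n" "A * mat_inv A = 1\<^sub>m n" "mat_inv A * A = 1\<^sub>m n"
proof -
  have "A \<in> Units (ring_mat TYPE('a) n ())"
    using det_non_zero_imp_unit[OF A, of "()"] inv invertible_mat_iff_det[OF A] by blast
  then obtain B where "mat_inverse A = Some B"
    using mat_inverse(1)[OF A, of "()"] by (cases "mat_inverse A") auto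
  with mat_inverse(2)[OF A this]
  show "mat_inv A \<in> carrier_mat n n" "A * mat_inv A = 1\<^sub>m n" "mat_inv A * A = 1\<^sub>m n"
    by (auto simp: mat_inv_def)
qed

lemma right_inverse_imp_invertible:
  fixes A :: "'a::field mat"
  assumes A: "A \<in> carrier_mat n n" and B: "B \<in> carrier_mat n n" and AB: "A * B = 1\<^sub>m n"
  shows "invertible_mat A"
  using det_mult[OF A B] AB by (auto simp: invertible_mat_iff_det[OF A])

lemma mat_inv_eqI:
  fixes A :: "'a::field mat"
  assumes A: "A \<in> carrier_mat n n" and B: "B \<in> carrier_mat n n" and AB: "A * B = 1\<^sub>m n"
  shows "mat_inv A = B"
proof -
  note i = mat_inv[OF A right_inverse_imp_invertible[OF A B AB]]
  have "mat_inv A = mat_inv A * (A * B)" using i(1) by (simp add: AB)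
  also have "\<dots> = B" using i A B by (simp flip: assoc_mult_mat)
  finally show ?thesis .
qed

text \<open>A block row of the matrix meets only the block row with the same number of any right
  factor. Hence the diagonal blocks of the inverse already invert the blocks; conversely, blockwise
  inverses assemble to an inverse.\<close>

lemma invertible_rect_block_diag_iff:
  fixes Y :: "nat \<Rightarrow> 'a::field mat"
  assumes Y: "\<And>i. i < s \<Longrightarrow> Y i \<in> carrier_mat r r"
  shows "invertible_mat (rect_block_diag s r r Y) \<longleftrightarrow> (\<forall>i<s. invertible_mat (Y i))"
proof (intro iffI allI impI)
  let ?D = "rect_block_diag s r r Y"
  assume inv: "invertible_mat ?D"
  fix k assume k: "k < s"
  note E = mat_inv[OF rect_block_diag_carrier inv]
  \<comment> \<open>The \<open>k\<close>-th diagonal block of the inverse, a candidate right inverse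
    of \<open>Y k\<close>. Off-diagonal blocks of the inverse do not enter the product computed
    below.\<close>
  define F where "F = mat r r (\<lambda>(i, j). mat_inv ?D $$ (k * r + i, k * r + j))"
  have F: "F \<in> carrier_mat r r" by (simp add: F_def)
  have "Y k * F = 1\<^sub>m r"
  proof (rule eq_matI)
    fix i j assume "i < dim_row (1\<^sub>m r :: 'a mat)" "j < dim_col (1\<^sub>m r :: 'a mat)"
    then have i: "i < r" and j: "j < r" by auto
    have j': "k * r + j < s * r" using k j by (simp add: block_index_less_iff)
    have "(Y k * F) $$ (i, j) = (\<Sum>l<r. Y k $$ (i, l) * mat_inv ?D $$ (k * r + l, k * r + j))"
      unfolding index_mult_mat_sum[OF Y[OF k] F i j] using j by (simp add: F_def)
    also have "\<dots> = (?D * mat_inv ?D) $$ (k * r + i, k * r + j)"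
      by (rule rect_block_diag_mult_index[OF E(1) k i j', symmetric])
    also have "\<dots> = (1\<^sub>m r :: 'a mat) $$ (i, j)"
      using i j k by (simp add: E(2) block_index_less_iff)
    finally show "(Y k * F) $$ (i, j) = (1\<^sub>m r :: 'a mat) $$ (i, j)" .
  qed (use Y[OF k] F in auto)
  then show "invertible_mat (Y k)"
    by (rule right_inverse_imp_invertible[OF Y[OF k] F])
next
  assume inv: "\<forall>i<s. invertible_mat (Y i)"
  have "rect_block_diag s r r Y * rect_block_diag s r r (\<lambda>i. mat_inv (Y i))
      = rect_block_diag s r r (\<lambda>i. Y i * mat_inv (Y i))"
    using Y inv by (intro rect_block_diag_mult) (auto intro: mat_inv)
  also have "\<dots> = 1\<^sub>m (s * r)"
    unfolding rect_block_diag_one[symmetric]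
    using Y inv by (intro rect_block_diag_cong) (auto intro: mat_inv)
  finally show "invertible_mat (rect_block_diag s r r Y)"
    by (rule right_inverse_imp_invertible[OF rect_block_diag_carrier rect_block_diag_carrier])
qed

lemma mat_inv_rect_block_diag:
  fixes Y :: "nat \<Rightarrow> 'a::field mat"
  assumes Y: "\<And>i. i < s \<Longrightarrow> Y i \<in> carrier_mat r r"
    and inv: "\<And>i. i < s \<Longrightarrow> invertible_mat (Y i)"
  shows "mat_inv (rect_block_diag s r r Y) = rect_block_diag s r r (\<lambda>i. mat_inv (Y i))"
proof (rule mat_inv_eqI[OF rect_block_diag_carrier rect_block_diag_carrier])
  have "rect_block_diag s r r Y * rect_block_diag s r r (\<lambda>i. mat_inv (Y i))
      = rect_block_diag s r r (\<lambda>i. Y i * mat_inv (Y i))"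
    using Y inv by (intro rect_block_diag_mult) (auto intro: mat_inv)
  also have "\<dots> = 1\<^sub>m (s * r)"
    unfolding rect_block_diag_one[symmetric]
    using Y inv by (intro rect_block_diag_cong) (auto intro: mat_inv)
  finally show "rect_block_diag s r r Y * rect_block_diag s r r (\<lambda>i. mat_inv (Y i)) = 1\<^sub>m (s * r)" .
qed

lemma kron_one_right_invertible:
  fixes X :: "'a::field mat"
  assumes X: "X \<in> carrier_mat s s" and inv: "invertible_mat X"
  shows "invertible_mat (kron X (1\<^sub>m N))"
proof (rule right_inverse_imp_invertible)
  note i = mat_inv[OF X inv]
  show "kron X (1\<^sub>m N) \<in> carrier_mat (s * N) (s * N)"
    "kron (mat_inv X) (1\<^sub>m N) \<in> carrier_mat (s * N) (s * N)"
    using X i by simp_all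
  show "kron X (1\<^sub>m N) * kron (mat_inv X) (1\<^sub>m N) = 1\<^sub>m (s * N)"
    using kron_mult[OF X one_carrier_mat i(1) one_carrier_mat, of N] by (simp add: i kron_one)
qed

section \<open>Spectrum and spectral radius\<close>

lemma spectrum_rect_block_diag:
  fixes Y :: "nat \<Rightarrow> 'a::field mat"
  assumes Y: "\<And>i. i < s \<Longrightarrow> Y i \<in> carrier_mat r r"
  shows "spectrum (rect_block_diag s r r Y) = (\<Union>i<s. spectrum (Y i))"
proof -
  have "eigenvalue (rect_block_diag s r r Y) e \<longleftrightarrow> (\<exists>i<s. eigenvalue (Y i) e)" for e
  proof -
    have c: "char_matrix (Y i) e \<in> carrier_mat r r" if "i < s" for i
      using Y[OF that] by (simp add: char_matrix_def)
    have "char_matrix (rect_block_diag s r r Y) e = rect_block_diag s r r (\<lambda>i. char_matrix (Y i) e)"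
    proof (rule rect_block_diag_eqI)
      show "char_matrix (rect_block_diag s r r Y) e \<in> carrier_mat (s * r) (s * r)"
        by (simp add: char_matrix_def)
      fix k l i j assume "k < s" "l < s" "i < r" "j < r"
      then show "char_matrix (rect_block_diag s r r Y) e $$ (k * r + i, l * r + j)
          = (if k = l then char_matrix (Y k) e $$ (i, j) else 0)"
        using carrier_matD[OF Y[of l]]
        by (simp add: char_matrix_def rect_block_diag_index block_index_less_iff block_index_eq_iff)
    qed
    then have "eigenvalue (rect_block_diag s r r Y) e
        \<longleftrightarrow> \<not> (\<forall>i<s. invertible_mat (char_matrix (Y i) e))"
      using invertible_rect_block_diag_iff[of s "\<lambda>i. char_matrix (Y i) e" r, OF c]
      by (auto simp: eigenvalue_det[OF rect_block_diag_carrier]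
          invertible_mat_iff_det[OF rect_block_diag_carrier])
    then show ?thesis
      using eigenvalue_det[OF Y] invertible_mat_iff_det[OF c] by auto
  qed
  then show ?thesis by (auto simp: spectrum_def)
qed

lemma spectral_radius_rect_block_diag:
  assumes Y: "\<And>i. i < s \<Longrightarrow> Y i \<in> carrier_mat r r" and s: "s \<ge> 1"
  shows "spectral_radius (rect_block_diag s r r Y) = Max ((\<lambda>i. spectral_radius (Y i)) ` {..<s})"
proof (cases "r = 0")
  case True
  \<comment> \<open>All spectra are empty, so both sides are the junk value \<open>Max {}\<close>.\<close>
  have "spectrum (Y i) = {}" if "i < s" for i
    using card_finite_spectrum[OF Y[OF that]] True by simp
  then have "spectral_radius (rect_block_diag s r r Y) = Max {}"
    "(\<lambda>i. spectral_radius (Y i)) ` {..<s} = (\<lambda>_. Max {}) ` {..<s}"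
    by (auto simp: spectral_radius_def spectrum_rect_block_diag[OF Y] intro!: image_cong)
  moreover have "(\<lambda>_. Max {}) ` {..<s} = {Max {} :: real}"
    using s by (intro image_constant[of 0]) auto
  ultimately show ?thesis by simp
next
  case False
  \<comment> \<open>Nonemptiness is where the complex field and \<open>r \<noteq> 0\<close> enter.
    It makes every maximum below an attained one, so the maximum over the union can be compared with
    the maximum of the maxima.\<close>
  have fin: "finite (norm ` spectrum (Y i))" and ne: "norm ` spectrum (Y i) \<noteq> {}" if "i < s" for i
    using card_finite_spectrum(1)[OF Y[OF that]] spectrum_non_empty[OF Y[OF that]] False by auto
  have eq: "norm ` spectrum (rect_block_diag s r r Y) = (\<Union>i<s. norm ` spectrum (Y i))"
    by (auto simp: spectrum_rect_block_diag[OF Y])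
  show ?thesis
    unfolding spectral_radius_def eq
  proof (rule Max_eqI)
    show "finite (\<Union>i<s. norm ` spectrum (Y i))" using fin by auto
    fix x assume "x \<in> (\<Union>i<s. norm ` spectrum (Y i))"
    then obtain i where i: "i < s" "x \<in> norm ` spectrum (Y i)" by auto
    then have "x \<le> Max (norm ` spectrum (Y i))" using fin by auto
    also have "\<dots> \<le> Max ((\<lambda>i. Max (norm ` spectrum (Y i))) ` {..<s})"
      using i by (intro Max_ge) auto
    finally show "x \<le> Max ((\<lambda>i. Max (norm ` spectrum (Y i))) ` {..<s})" .
  next
    have "Max ((\<lambda>i. Max (norm ` spectrum (Y i))) ` {..<s})
        \<in> (\<lambda>i. Max (norm ` spectrum (Y i))) ` {..<s}"
      using s by (intro Max_in) (auto simp: lessThan_empty_iff)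
    then obtain i where "i < s"
      "Max ((\<lambda>i. Max (norm ` spectrum (Y i))) ` {..<s}) = Max (norm ` spectrum (Y i))" by auto
    then show "Max ((\<lambda>i. Max (norm ` spectrum (Y i))) ` {..<s}) \<in> (\<Union>i<s. norm ` spectrum (Y i))"
      using Max_in[OF fin ne] by (metis UN_I lessThan_iff)
  qed
qed

lemma spectral_radius_similar:
  assumes "similar_mat A B"
  shows "spectral_radius A = spectral_radius B"
proof -
  from similar_matD[OF assms] obtain n where "A \<in> carrier_mat n n" "B \<in> carrier_mat n n" by auto
  then have "spectrum A = spectrum B"
    using char_poly_similar[OF assms] by (simp add: spectrum_root_char_poly)
  then show ?thesis by (simp add: spectral_radius_def)
qed

section \<open>Powers tending to zero, and convergence of the iteration\<close>

text \<open>Convergence expressed by the iteration matrix alone, without system matrix, right-hand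
  side or initial vector. In this form it can be moved along a similarity and tested on blocks. It
  is meant for square matrices, so one dimension bounds both indices.\<close>

definition powers_vanish :: "complex mat \<Rightarrow> bool" where
  "powers_vanish A \<longleftrightarrow> (\<forall>i<dim_row A. \<forall>j<dim_row A. (\<lambda>k. (A ^\<^sub>m k) $$ (i, j)) \<longlonglongrightarrow> 0)"

text \<open>With \<open>A = P * B * Q\<close> a similarity, each entry of the \<open>k\<close>-th
  power of \<open>A\<close> is a finite combination of entries of the \<open>k\<close>-th power of
  \<open>B\<close>, with coefficients independent of \<open>k\<close>.\<close>

lemma powers_vanish_similar_imp:
  assumes "similar_mat A B" "powers_vanish B"
  shows "powers_vanish A"
proof -
  from assms(1) obtain P Q where wit: "similar_mat_wit A B P Q" by (auto simp: similar_mat_def)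
  define n where "n = dim_row A"
  from similar_mat_witD[OF n_def wit]
  have A: "A \<in> carrier_mat n n" and B: "B \<in> carrier_mat n n"
    and P: "P \<in> carrier_mat n n" and Q: "Q \<in> carrier_mat n n" by auto
  have Bk: "B ^\<^sub>m k \<in> carrier_mat n n" for k using B by simp
  have PBk: "P * B ^\<^sub>m k \<in> carrier_mat n n" for k using P B by simp
  have "(\<lambda>k. (A ^\<^sub>m k) $$ (i, j)) \<longlonglongrightarrow> 0" if ij: "i < n" "j < n" for i j
  proof -
    have "(A ^\<^sub>m k) $$ (i, j) = (\<Sum>l<n. (\<Sum>q<n. P $$ (i, q) * (B ^\<^sub>m k) $$ (q, l)) * Q $$ (l, j))" for k
    proof -
      have "(A ^\<^sub>m k) $$ (i, j) = (\<Sum>l<n. (P * B ^\<^sub>m k) $$ (i, l) * Q $$ (l, j))"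
        unfolding similar_mat_wit_pow_id[OF wit] by (rule index_mult_mat_sum[OF PBk Q ij])
      then show ?thesis by (simp add: index_mult_mat_sum[OF P Bk ij(1)])
    qed
    moreover have "(\<lambda>k. \<Sum>l<n. (\<Sum>q<n. P $$ (i, q) * (B ^\<^sub>m k) $$ (q, l)) * Q $$ (l, j)) \<longlonglongrightarrow> 0"
      using assms(2) B
      by (intro tendsto_null_sum tendsto_mult_left_zero tendsto_mult_right_zero)
        (auto simp: powers_vanish_def)
    ultimately show ?thesis by simp
  qed
  then show ?thesis using A by (auto simp: powers_vanish_def)
qed

lemma powers_vanish_similar:
  assumes "similar_mat A B"
  shows "powers_vanish A \<longleftrightarrow> powers_vanish B"
  using powers_vanish_similar_imp assms similar_mat_sym by blast

text \<open>Powers are taken blockwise: an entry of the large power is either an entry of a block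
  power or constantly zero.\<close>

lemma powers_vanish_rect_block_diag:
  assumes Y: "\<And>i. i < s \<Longrightarrow> Y i \<in> carrier_mat r r"
  shows "powers_vanish (rect_block_diag s r r Y) \<longleftrightarrow> (\<forall>i<s. powers_vanish (Y i))"
proof (intro iffI allI impI)
  assume D: "powers_vanish (rect_block_diag s r r Y)"
  fix k assume k: "k < s"
  show "powers_vanish (Y k)"
    unfolding powers_vanish_def
  proof (intro allI impI)
    fix i j assume "i < dim_row (Y k)" "j < dim_row (Y k)"
    then have ij: "i < r" "j < r" using Y[OF k] by auto
    then have "(\<lambda>p. (rect_block_diag s r r Y ^\<^sub>m p) $$ (k * r + i, k * r + j)) \<longlonglongrightarrow> 0"
      using D k by (simp add: powers_vanish_def block_index_less_iff)
    then show "(\<lambda>p. (Y k ^\<^sub>m p) $$ (i, j)) \<longlonglongrightarrow> 0"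
      by (simp add: rect_block_diag_pow[OF Y] rect_block_diag_index k ij)
  qed
next
  assume *: "\<forall>i<s. powers_vanish (Y i)"
  show "powers_vanish (rect_block_diag s r r Y)"
    unfolding powers_vanish_def rect_block_diag_dim
  proof (intro allI impI)
    fix i' j' assume "i' < s * r" "j' < s * r"
    then obtain k i l j where k: "k < s" "i < r" "i' = k * r + i" and l: "l < s" "j < r" "j' = l * r + j"
      by (elim block_indexE)
    have "(\<lambda>p. (Y k ^\<^sub>m p) $$ (i, j)) \<longlonglongrightarrow> 0"
      using * carrier_matD[OF Y[OF k(1)]] k l by (simp add: powers_vanish_def)
    then show "(\<lambda>p. (rect_block_diag s r r Y ^\<^sub>m p) $$ (i', j')) \<longlonglongrightarrow> 0"
      using k l by (cases "k = l") (simp_all add: rect_block_diag_pow[OF Y] rect_block_diag_index)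
  qed
qed

text \<open>The affine term is chosen so that the solution \<open>z\<close> is a fixed point: in one
  step the two contributions \<open>T *\<^sub>v z\<close> cancel, and only the error is multiplied
  by \<open>T\<close>.\<close>

lemma iteration_error:
  assumes T: "T \<in> carrier_mat n n" and C: "C \<in> carrier_mat n n" "invertible_mat C"
    and b: "b \<in> carrier_vec n" and x0: "x0 \<in> carrier_vec n"
  shows "iteration T C b x0 k = mat_inv C *\<^sub>v b + T ^\<^sub>m k *\<^sub>v (x0 - mat_inv C *\<^sub>v b)"
proof -
  define z where "z = mat_inv C *\<^sub>v b"
  have z: "z \<in> carrier_vec n" using mat_inv(1)[OF C] b by (simp add: z_def)
  define e where "e = x0 - z"
  have e: "e \<in> carrier_vec n" using x0 z by (simp add: e_def)
  \<comment> \<open>\<open>^\<^sub>m\<close> appends its new factor on the right, whereas the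
    iteration applies \<open>T\<close> on the left.\<close>
  have pow: "T * T ^\<^sub>m k = T ^\<^sub>m k * T" for k
  proof (induction k)
    case (Suc k)
    have "T * (T ^\<^sub>m k * T) = T * T ^\<^sub>m k * T"
      using T by (intro assoc_mult_mat[symmetric]) auto
    then show ?case using Suc by simp
  qed (use T in simp)
  have "((\<lambda>x. T *\<^sub>v x + (1\<^sub>m n - T) *\<^sub>v z) ^^ k) x0 = z + T ^\<^sub>m k *\<^sub>v e"
  proof (induction k)
    case 0
    show ?case using T x0 z by (intro eq_vecI) (auto simp: e_def)
  next
    case (Suc k)
    have Tk: "T ^\<^sub>m k *\<^sub>v e \<in> carrier_vec n" using T e by (meson mult_mat_vec_carrier pow_carrier_mat)
    have Tz: "T *\<^sub>v z \<in> carrier_vec n" using T z by simp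
    have TTk: "T *\<^sub>v (T ^\<^sub>m k *\<^sub>v e) \<in> carrier_vec n" using T Tk by simp
    have "((\<lambda>x. T *\<^sub>v x + (1\<^sub>m n - T) *\<^sub>v z) ^^ Suc k) x0
        = T *\<^sub>v (z + T ^\<^sub>m k *\<^sub>v e) + (1\<^sub>m n - T) *\<^sub>v z"
      by (simp add: Suc)
    also have "\<dots> = (T *\<^sub>v z + T *\<^sub>v (T ^\<^sub>m k *\<^sub>v e)) + (z - T *\<^sub>v z)"
      using T z Tk minus_mult_distrib_mat_vec[OF one_carrier_mat T z]
      by (simp add: mult_add_distrib_mat_vec[OF T z Tk])
    also have "\<dots> = z + T *\<^sub>v (T ^\<^sub>m k *\<^sub>v e)"
      using z Tz TTk by (intro eq_vecI) auto
    also have "T *\<^sub>v (T ^\<^sub>m k *\<^sub>v e) = T ^\<^sub>m Suc k *\<^sub>v e"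
      using T e pow[of k] assoc_mult_mat_vec[OF T pow_carrier_mat[OF T] e, of k] by simp
    finally show ?case .
  qed
  then show ?thesis using C by (simp add: iteration_def z_def e_def)
qed

text \<open>\<open>C\<close> determines the limit but not the error propagation. This makes
  iterations for different system matrices comparable.\<close>

lemma iteration_converges_iff_powers_vanish:
  assumes T: "T \<in> carrier_mat n n" and C: "C \<in> carrier_mat n n" "invertible_mat C"
  shows "iteration_converges T C \<longleftrightarrow> powers_vanish T"
proof
  have Ci: "mat_inv C \<in> carrier_mat n n" by (rule mat_inv(1)[OF C])
  have Tk: "T ^\<^sub>m k \<in> carrier_mat n n" for k using T by simp
  {
    assume conv: "iteration_converges T C"
    show "powers_vanish T"
      unfolding powers_vanish_def
    proof (intro allI impI)
      fix i j assume "i < dim_row T" "j < dim_row T"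
      then have ij: "i < n" "j < n" using T by auto
      have 0: "mat_inv C *\<^sub>v 0\<^sub>v n = 0\<^sub>v n" using Ci by (intro eq_vecI) auto
      \<comment> \<open>Right-hand side zero puts the solution at zero; starting from the
        \<open>j\<close>-th unit vector, the \<open>k\<close>-th iterate is then the
        \<open>j\<close>-th column of the \<open>k\<close>-th power of \<open>T\<close>.\<close>
      have "vec_tendsto (iteration T C (0\<^sub>v n) (unit_vec n j)) (0\<^sub>v n)"
        using conv C unfolding iteration_converges_def by (metis 0 carrier_matD(1) unit_vec_carrier zero_carrier_vec)
      then have "(\<lambda>k. vec_index (iteration T C (0\<^sub>v n) (unit_vec n j) k) i) \<longlonglongrightarrow> 0"
        using ij by (auto simp: vec_tendsto_def)
      moreover have "vec_index (iteration T C (0\<^sub>v n) (unit_vec n j) k) i = (T ^\<^sub>m k) $$ (i, j)" for k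
      proof -
        have "unit_vec n j - 0\<^sub>v n = (unit_vec n j :: complex vec)" by (intro eq_vecI) auto
        moreover have "vec_index (T ^\<^sub>m k *\<^sub>v unit_vec n j) i = (T ^\<^sub>m k) $$ (i, j)"
          using T ij by simp
        ultimately show ?thesis
          using iteration_error[OF T C zero_carrier_vec unit_vec_carrier, of j k] ij Tk[of k]
          by (simp add: 0)
      qed
      ultimately show "(\<lambda>k. (T ^\<^sub>m k) $$ (i, j)) \<longlonglongrightarrow> 0" by simp
    qed
  }
  assume van: "powers_vanish T"
  show "iteration_converges T C"
    unfolding iteration_converges_def vec_tendsto_def
  proof (intro ballI allI impI)
    fix b x0 :: "complex vec" and i
    assume "b \<in> carrier_vec (dim_row C)" "x0 \<in> carrier_vec (dim_row C)"
      and "i < dim_vec (mat_inv C *\<^sub>v b)"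
    then have b: "b \<in> carrier_vec n" and x0: "x0 \<in> carrier_vec n" and i: "i < n"
      using C Ci by auto
    define z where "z = mat_inv C *\<^sub>v b"
    have z: "z \<in> carrier_vec n" using Ci b by (simp add: z_def)
    have "vec_index (iteration T C b x0 k) i
        = vec_index z i + (\<Sum>j<n. (T ^\<^sub>m k) $$ (i, j) * vec_index (x0 - z) j)" for k
      unfolding iteration_error[OF T C b x0] z_def[symmetric]
      using T x0 z i by (simp add: scalar_prod_def atLeast0LessThan)
    moreover have "(\<lambda>k. vec_index z i + (\<Sum>j<n. (T ^\<^sub>m k) $$ (i, j) * vec_index (x0 - z) j))
        \<longlonglongrightarrow> vec_index z i + 0"
      using van T i
      by (intro tendsto_add tendsto_const tendsto_null_sum tendsto_mult_left_zero)
        (auto simp: powers_vanish_def)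
    ultimately show "(\<lambda>k. vec_index (iteration T C b x0 k) i) \<longlonglongrightarrow> vec_index (mat_inv C *\<^sub>v b) i"
      by (simp add: z_def)
  qed
qed

section \<open>Intertwining relations and the two-grid matrix\<close>

lemma two_grid_mat_carrier:
  assumes "Bh \<in> carrier_mat p p" "W \<in> carrier_mat p p" "invertible_mat W"
    "P \<in> carrier_mat p q" "R \<in> carrier_mat q p"
  shows "two_grid_mat P R BH Bh W \<nu> \<in> carrier_mat p p"
proof -
  note mat_inv(1)[OF assms(2,3)]
  then have "smoother_mat W Bh \<in> carrier_mat p p"
    using assms by (auto simp: smoother_mat_def)
  then have "smoother_mat W Bh ^\<^sub>m \<nu> \<in> carrier_mat p p" by simp
  moreover have "P * mat_inv BH * R * Bh \<in> carrier_mat p p"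
    using assms(1,4) by (intro carrier_matI) simp_all
  ultimately show ?thesis
    using assms(1) mult_carrier_mat[OF minus_carrier_mat[of _ p p "1\<^sub>m p"]]
    by (simp add: two_grid_mat_def)
qed

text \<open>Pasting of two commuting squares along the shared matrix \<open>Y\<close>. The three
  sizes are independent, so a path may go from the fine to the coarse level and back.\<close>

lemma intertwine_mult:
  fixes A B C D :: "'a::semiring_1 mat"
  assumes "A \<in> carrier_mat p q" "B \<in> carrier_mat p q" "C \<in> carrier_mat q r" "D \<in> carrier_mat q r"
    and "X \<in> carrier_mat p p" "Y \<in> carrier_mat q q" "Z \<in> carrier_mat r r"
    and "A * Y = X * B" "C * Z = Y * D"
  shows "(A * C) * Z = X * (B * D)"
proof -
  have "(A * C) * Z = A * (Y * D)" using assms by (simp flip: assms(9))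
  also have "\<dots> = (X * B) * D" using assms by (simp flip: assms(8))
  also have "\<dots> = X * (B * D)" using assms by simp
  finally show ?thesis .
qed

lemma intertwine_one_minus:
  fixes A B :: "'a::ring_1 mat"
  assumes A: "A \<in> carrier_mat p p" and B: "B \<in> carrier_mat p p" and X: "X \<in> carrier_mat p p"
    and eq: "A * X = X * B"
  shows "(1\<^sub>m p - A) * X = X * (1\<^sub>m p - B)"
  using minus_mult_distrib_mat[OF one_carrier_mat A X] mult_minus_distrib_mat[OF X one_carrier_mat B]
    X eq by simp

lemma intertwine_pow:
  fixes A B :: "'a::semiring_1 mat"
  assumes A: "A \<in> carrier_mat p p" and B: "B \<in> carrier_mat p p" and X: "X \<in> carrier_mat p p"
    and eq: "A * X = X * B"
  shows "A ^\<^sub>m k * X = X * B ^\<^sub>m k"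
proof (induction k)
  case 0
  then show ?case using assms by simp
next
  case (Suc k)
  then show ?case
    using intertwine_mult[of "A ^\<^sub>m k" p p "B ^\<^sub>m k" A p B X X X] assms by simp
qed

text \<open>In a field the nonzero \<open>det X\<close> cancels from the determinants of both sides.
  This is how nonsingularity of the coupled matrices reaches their block diagonal
  counterparts.\<close>

lemma intertwine_invertible:
  fixes A B :: "'a::field mat"
  assumes A: "A \<in> carrier_mat p p" and B: "B \<in> carrier_mat p p" and X: "X \<in> carrier_mat p p"
    and eq: "A * X = X * B" and inv: "invertible_mat A" "invertible_mat X"
  shows "invertible_mat B"
proof -
  have "det A * det X = det X * det B"
    using arg_cong[OF eq, of det] by (simp add: det_mult[OF A X] det_mult[OF X B])
  then show ?thesis
    using inv by (auto simp: invertible_mat_iff_det[OF A] invertible_mat_iff_det[OF B]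
        invertible_mat_iff_det[OF X])
qed

text \<open>Insert \<open>B * mat_inv B\<close> behind \<open>X\<close> and read the relation
  backwards, turning \<open>X * B\<close> into \<open>A * X\<close>; then \<open>mat_inv A\<close>
  cancels \<open>A\<close>.\<close>

lemma intertwine_mat_inv:
  fixes A B :: "'a::field mat"
  assumes A: "A \<in> carrier_mat p p" and B: "B \<in> carrier_mat p p" and X: "X \<in> carrier_mat p p"
    and eq: "A * X = X * B" and inv: "invertible_mat A" "invertible_mat B"
  shows "mat_inv A * X = X * mat_inv B"
proof -
  note a = mat_inv[OF A inv(1)] and b = mat_inv[OF B inv(2)]
  have "mat_inv A * X = mat_inv A * (X * (B * mat_inv B))" using X by (simp add: b)
  also have "\<dots> = mat_inv A * ((A * X) * mat_inv B)"
    unfolding eq using B X b(1) by simp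
  also have "\<dots> = (mat_inv A * A) * (X * mat_inv B)"
    using A X a(1) b(1) by (simp add: assoc_mult_mat[of _ p p _ p _ p])
  also have "\<dots> = X * mat_inv B" using X b(1) by (simp add: a)
  finally show ?thesis .
qed

text \<open>\<open>X\<close> belongs to the fine level and \<open>Y\<close> to the coarse one. The
  squares for \<open>P\<close>, the coarse inverse, \<open>R\<close> and \<open>Bh\<close> are
  pasted in this order; the resulting path starts and ends at \<open>X\<close>, so it can be
  subtracted from the identity and combined with the smoother.\<close>

lemma intertwine_two_grid_mat:
  assumes Bh: "Bh \<in> carrier_mat p p" "Dh \<in> carrier_mat p p"
    and BH: "BH \<in> carrier_mat q q" "DH \<in> carrier_mat q q" "invertible_mat BH" "invertible_mat DH"
    and W: "W \<in> carrier_mat p p" "V \<in> carrier_mat p p" "invertible_mat W" "invertible_mat V"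
    and P: "P \<in> carrier_mat p q" "P' \<in> carrier_mat p q"
    and R: "R \<in> carrier_mat q p" "R' \<in> carrier_mat q p"
    and X: "X \<in> carrier_mat p p" and Y: "Y \<in> carrier_mat q q"
    and eq: "Bh * X = X * Dh" "BH * Y = Y * DH" "W * X = X * V" "P * Y = X * P'" "R * X = Y * R'"
  shows "two_grid_mat P R BH Bh W \<nu> * X = X * two_grid_mat P' R' DH Dh V \<nu>"
proof -
  note BHi = mat_inv(1)[OF BH(1,3)] mat_inv(1)[OF BH(2,4)]
  note Wi = mat_inv(1)[OF W(1,3)] mat_inv(1)[OF W(2,4)]
  have dims: "dim_row Bh = p" "dim_row Dh = p" using Bh by auto
  note WBh = mult_carrier_mat[OF Wi(1) Bh(1)] mult_carrier_mat[OF Wi(2) Bh(2)]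
  have Sc: "smoother_mat W Bh \<in> carrier_mat p p" "smoother_mat V Dh \<in> carrier_mat p p"
    unfolding smoother_mat_def dims by (rule minus_carrier_mat, rule WBh)+
  have "mat_inv W * Bh * X = X * (mat_inv V * Dh)"
    by (rule intertwine_mult[OF Wi Bh X X X intertwine_mat_inv[OF W(1,2) X eq(3) W(3,4)] eq(1)])
  then have S: "smoother_mat W Bh * X = X * smoother_mat V Dh"
    unfolding smoother_mat_def dims by (rule intertwine_one_minus[OF WBh X])
  note C1 = mult_carrier_mat[OF P(1) BHi(1)] mult_carrier_mat[OF P(2) BHi(2)]
  note C2 = mult_carrier_mat[OF C1(1) R(1)] mult_carrier_mat[OF C1(2) R(2)]
  note C3 = mult_carrier_mat[OF C2(1) Bh(1)] mult_carrier_mat[OF C2(2) Bh(2)]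
  have "P * mat_inv BH * Y = X * (P' * mat_inv DH)"
    by (rule intertwine_mult[OF P BHi X Y Y eq(4) intertwine_mat_inv[OF BH(1,2) Y eq(2) BH(3,4)]])
  then have "P * mat_inv BH * R * X = X * (P' * mat_inv DH * R')"
    by (rule intertwine_mult[OF C1 R X Y X _ eq(5)])
  then have "P * mat_inv BH * R * Bh * X = X * (P' * mat_inv DH * R' * Dh)"
    by (rule intertwine_mult[OF C2 Bh X X X _ eq(1)])
  then have C: "(1\<^sub>m p - P * mat_inv BH * R * Bh) * X = X * (1\<^sub>m p - P' * mat_inv DH * R' * Dh)"
    by (rule intertwine_one_minus[OF C3 X])
  show ?thesis
    unfolding two_grid_mat_def dims
    by (rule intertwine_mult[OF minus_carrier_mat[OF C3(1)] minus_carrier_mat[OF C3(2)]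
          pow_carrier_mat[OF Sc(1)] pow_carrier_mat[OF Sc(2)] X X X C intertwine_pow[OF Sc X S]])
qed

lemma two_grid_mat_rect_block_diag:
  assumes Bh: "\<And>i. i < s \<Longrightarrow> Bh i \<in> carrier_mat p p"
    and BH: "\<And>i. i < s \<Longrightarrow> BH i \<in> carrier_mat q q" "\<And>i. i < s \<Longrightarrow> invertible_mat (BH i)"
    and W: "\<And>i. i < s \<Longrightarrow> W i \<in> carrier_mat p p" "\<And>i. i < s \<Longrightarrow> invertible_mat (W i)"
    and P: "\<And>i. i < s \<Longrightarrow> P i \<in> carrier_mat p q" and R: "\<And>i. i < s \<Longrightarrow> R i \<in> carrier_mat q p"
  shows "two_grid_mat (rect_block_diag s p q P) (rect_block_diag s q p R)
      (rect_block_diag s q q BH) (rect_block_diag s p p Bh) (rect_block_diag s p p W) \<nu>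
    = rect_block_diag s p p (\<lambda>i. two_grid_mat (P i) (R i) (BH i) (Bh i) (W i) \<nu>)"
proof -
  note BHi = mat_inv(1)[OF BH] and Wi = mat_inv(1)[OF W]
  \<comment> \<open>The large identity is itself rewritten as a block diagonal matrix
    (\<open>flip: rect_block_diag_one\<close>), so that the difference is taken between two block
    diagonals; the same device gives \<open>C\<close>.\<close>
  have S: "smoother_mat (rect_block_diag s p p W) (rect_block_diag s p p Bh)
      = rect_block_diag s p p (\<lambda>i. 1\<^sub>m p - mat_inv (W i) * Bh i)"
    unfolding smoother_mat_def rect_block_diag_dim
    using Wi Bh W mult_carrier_mat[OF Wi Bh]
    by (simp add: mat_inv_rect_block_diag rect_block_diag_mult rect_block_diag_minus
        flip: rect_block_diag_one)
  have Sc: "1\<^sub>m p - mat_inv (W i) * Bh i \<in> carrier_mat p p" if "i < s" for i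
    using Wi[OF that that] Bh[OF that] by auto
  have P1: "P i * mat_inv (BH i) \<in> carrier_mat p q" if "i < s" for i
    using P[OF that] BHi[OF that that] by auto
  have P2: "P i * mat_inv (BH i) * R i \<in> carrier_mat p p" if "i < s" for i
    using P1[OF that] R[OF that] by auto
  have P3: "P i * mat_inv (BH i) * R i * Bh i \<in> carrier_mat p p" if "i < s" for i
    using P2[OF that] Bh[OF that] by auto
  have C: "1\<^sub>m (s * p) - rect_block_diag s p q P * mat_inv (rect_block_diag s q q BH)
        * rect_block_diag s q p R * rect_block_diag s p p Bh
      = rect_block_diag s p p (\<lambda>i. 1\<^sub>m p - P i * mat_inv (BH i) * R i * Bh i)"
    using P BH BHi R Bh P1 P2 P3
    by (simp add: mat_inv_rect_block_diag rect_block_diag_mult rect_block_diag_minus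
        flip: rect_block_diag_one)
  have "two_grid_mat (rect_block_diag s p q P) (rect_block_diag s q p R)
      (rect_block_diag s q q BH) (rect_block_diag s p p Bh) (rect_block_diag s p p W) \<nu>
    = rect_block_diag s p p (\<lambda>i. (1\<^sub>m p - P i * mat_inv (BH i) * R i * Bh i)
        * (1\<^sub>m p - mat_inv (W i) * Bh i) ^\<^sub>m \<nu>)"
    unfolding two_grid_mat_def S rect_block_diag_dim C
    using Sc P3 minus_carrier_mat[OF P3]
    by (subst rect_block_diag_pow; (intro rect_block_diag_mult)?) auto
  also have "\<dots> = rect_block_diag s p p (\<lambda>i. two_grid_mat (P i) (R i) (BH i) (Bh i) (W i) \<nu>)"
    using Bh by (intro rect_block_diag_cong) (auto simp: two_grid_mat_def smoother_mat_def)
  finally show ?thesis .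
qed

section \<open>Stage-coupled and single-stage matrices\<close>

lemma cmat_carrier [simp]: "A \<in> carrier_mat p q \<Longrightarrow> cmat A \<in> carrier_mat p q"
  by (simp add: cmat_def)

lemma stage_coupled_mat_carrier:
  assumes "A \<in> carrier_mat s s" "M \<in> carrier_mat N N" "K \<in> carrier_mat N N"
  shows "stage_coupled_mat \<Delta>t A M K \<in> carrier_mat (s * N) (s * N)"
  using assms kron_carrier[OF one_carrier_mat assms(2), of s] kron_carrier[OF assms(1,3)]
  by (auto simp: stage_coupled_mat_def)

lemma cmat_stage_coupled_mat:
  assumes A: "A \<in> carrier_mat s s" and M: "M \<in> carrier_mat N N" and K: "K \<in> carrier_mat N N"
  shows "cmat (stage_coupled_mat \<Delta>t A M K)
    = kron (1\<^sub>m s) (cmat M) + of_real \<Delta>t \<cdot>\<^sub>m kron (cmat A) (cmat K)"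
proof (rule eq_mat_blockI)
  note c = cmat_carrier[OF A] cmat_carrier[OF M] cmat_carrier[OF K]
  note k = kron_carrier[OF one_carrier_mat M, of s] kron_carrier[OF A K]
    kron_carrier[OF one_carrier_mat c(2), of s] kron_carrier[OF c(1,3)]
  show "cmat (stage_coupled_mat \<Delta>t A M K) \<in> carrier_mat (s * N) (s * N)"
    by (rule cmat_carrier[OF stage_coupled_mat_carrier[OF A M K]])
  show "kron (1\<^sub>m s) (cmat M) + of_real \<Delta>t \<cdot>\<^sub>m kron (cmat A) (cmat K) \<in> carrier_mat (s * N) (s * N)"
    by (rule add_carrier_mat[OF smult_carrier_mat[OF k(4)]])
  fix p q i j assume ij: "p < s" "q < s" "i < N" "j < N"
  then have "cmat (stage_coupled_mat \<Delta>t A M K) $$ (p * N + i, q * N + j)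
      = of_real (1\<^sub>m s $$ (p, q) * M $$ (i, j) + \<Delta>t * (A $$ (p, q) * K $$ (i, j)))"
    using carrier_matD[OF A] carrier_matD[OF k(2)]
    by (simp add: cmat_def stage_coupled_mat_def block_index_less_iff
        kron_index_block[OF one_carrier_mat M] kron_index_block[OF A K] del: index_one_mat)
  also have "\<dots> = (kron (1\<^sub>m s) (cmat M) + of_real \<Delta>t \<cdot>\<^sub>m kron (cmat A) (cmat K)) $$ (p * N + i, q * N + j)"
    using ij carrier_matD[OF k(4)] carrier_matD[OF A] carrier_matD[OF M] carrier_matD[OF K]
    by (simp add: block_index_less_iff kron_index_block[OF one_carrier_mat c(2)]
        kron_index_block[OF c(1,3)]) (simp add: cmat_def)
  finally show "cmat (stage_coupled_mat \<Delta>t A M K) $$ (p * N + i, q * N + j)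
    = (kron (1\<^sub>m s) (cmat M) + of_real \<Delta>t \<cdot>\<^sub>m kron (cmat A) (cmat K)) $$ (p * N + i, q * N + j)" .
qed

lemma single_stage_mat_carrier:
  assumes "M \<in> carrier_mat N N" "K \<in> carrier_mat N N"
  shows "single_stage_mat z M K \<in> carrier_mat N N"
  using assms by (auto simp: single_stage_mat_def)

text \<open>With the Butcher matrix replaced by its eigenvalues, both summands vanish off the
  diagonal blocks, and block \<open>i\<close> becomes the mass block plus
  \<open>lam i * of_real \<Delta>t\<close> times the stiffness block.\<close>

lemma stage_coupled_mat_mat_diag:
  assumes M: "M \<in> carrier_mat N N" and K: "K \<in> carrier_mat N N"
  shows "kron (1\<^sub>m s) (cmat M) + of_real \<Delta>t \<cdot>\<^sub>m kron (mat_diag s lam) (cmat K)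
    = rect_block_diag s N N (\<lambda>i. single_stage_mat (lam i * of_real \<Delta>t) M K)"
proof (rule rect_block_diag_eqI)
  note c = cmat_carrier[OF M] cmat_carrier[OF K]
  note k = kron_carrier[OF one_carrier_mat c(1), of s] kron_carrier[OF mat_diag_dim c(2)]
  show "kron (1\<^sub>m s) (cmat M) + of_real \<Delta>t \<cdot>\<^sub>m kron (mat_diag s lam) (cmat K)
      \<in> carrier_mat (s * N) (s * N)"
    by (rule add_carrier_mat[OF smult_carrier_mat[OF k(2)]])
  fix p q i j assume "p < s" "q < s" "i < N" "j < N"
  then show "(kron (1\<^sub>m s) (cmat M) + of_real \<Delta>t \<cdot>\<^sub>m kron (mat_diag s lam) (cmat K)) $$ (p * N + i, q * N + j)
      = (if p = q then single_stage_mat (lam p * of_real \<Delta>t) M K $$ (i, j) else 0)"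
    using carrier_matD[OF k(2)[of s lam]] carrier_matD[OF c(2)]
    by (simp add: block_index_less_iff kron_index_block[OF one_carrier_mat c(1)]
        kron_index_block[OF mat_diag_dim c(2)] single_stage_mat_def) (simp add: mat_diag_def)
qed

text \<open>By the mixed-product rule \<open>kron X (1\<^sub>m N)\<close> commutes with the mass
  part, both products being \<open>kron X (cmat M)\<close>; in the stiffness part the first factors
  give \<open>cmat A * X = X * mat_diag s lam\<close>. As \<open>N\<close> is arbitrary, this serves
  both levels.\<close>

lemma intertwine_stage_coupled_mat:
  assumes A: "A \<in> carrier_mat s s" and M: "M \<in> carrier_mat N N" and K: "K \<in> carrier_mat N N"
    and X: "X \<in> carrier_mat s s" and eq: "cmat A * X = X * mat_diag s lam"
  shows "cmat (stage_coupled_mat \<Delta>t A M K) * kron X (1\<^sub>m N)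
    = kron X (1\<^sub>m N) * rect_block_diag s N N (\<lambda>i. single_stage_mat (lam i * of_real \<Delta>t) M K)"
proof -
  let ?d = "complex_of_real \<Delta>t" and ?X = "kron X (1\<^sub>m N)"
  note c = cmat_carrier[OF A] cmat_carrier[OF M] cmat_carrier[OF K]
  have L: "mat_diag s lam \<in> carrier_mat s s" by (rule mat_diag_dim)
  note k = kron_carrier[OF one_carrier_mat c(2), of s] kron_carrier[OF c(1,3)]
    kron_carrier[OF L c(3)] kron_carrier[OF X one_carrier_mat, of N]
  have "(kron (1\<^sub>m s) (cmat M) + ?d \<cdot>\<^sub>m kron (cmat A) (cmat K)) * ?X
      = kron (1\<^sub>m s) (cmat M) * ?X + ?d \<cdot>\<^sub>m (kron (cmat A) (cmat K) * ?X)"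
    using k add_mult_distrib_mat[OF k(1) smult_carrier_mat[OF k(2)] k(4)]
      mult_smult_assoc_mat[OF k(2,4)] by simp
  also have "kron (1\<^sub>m s) (cmat M) * ?X = ?X * kron (1\<^sub>m s) (cmat M)"
    using c X by (simp add: kron_mult[of _ s s _ N N _ s _ N])
  also have "kron (cmat A) (cmat K) * ?X = ?X * kron (mat_diag s lam) (cmat K)"
    using c X L by (simp add: kron_mult[of _ s s _ N N _ s _ N] eq)
  also have "?X * kron (1\<^sub>m s) (cmat M) + ?d \<cdot>\<^sub>m (?X * kron (mat_diag s lam) (cmat K))
      = ?X * (kron (1\<^sub>m s) (cmat M) + ?d \<cdot>\<^sub>m kron (mat_diag s lam) (cmat K))"
    using k mult_add_distrib_mat[OF k(4) k(1) smult_carrier_mat[OF k(3)]]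
      mult_smult_distrib[OF k(4) k(3)] by simp
  finally show ?thesis
    by (simp add: cmat_stage_coupled_mat[OF A M K] stage_coupled_mat_mat_diag[OF M K])
qed

lemma invertible_cmat:
  assumes A: "A \<in> carrier_mat n n" and inv: "invertible_mat A"
  shows "invertible_mat (cmat A)"
proof (rule right_inverse_imp_invertible[OF cmat_carrier[OF A] cmat_carrier[OF mat_inv(1)[OF A inv]]])
  have "cmat A * cmat (mat_inv A) = cmat (A * mat_inv A)"
    unfolding cmat_def by (rule of_real_hom.mat_hom_mult[OF A mat_inv(1)[OF A inv], symmetric])
  also have "\<dots> = 1\<^sub>m n"
    by (simp add: mat_inv(2)[OF A inv] cmat_def of_real_hom.mat_hom_one)
  finally show "cmat A * cmat (mat_inv A) = 1\<^sub>m n" .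
qed

section \<open>Reduction of the stage-coupled two-grid method to its stages\<close>

theorem theorem3p7:
  fixes J :: "'v::{real_inner, complete_space} \<Rightarrow> 'w::{real_inner, complete_space}"
    and m a :: "'v \<Rightarrow> 'v \<Rightarrow> real"
    and Vh VH :: "'v set" and \<phi> \<psi> :: "nat \<Rightarrow> 'v"
    and N n s \<nu> :: nat and \<Delta>t :: real
    and Mh Kh MH KH P R A Bh BH :: "real mat"
    and X Xh W T :: "complex mat"
    and lam :: "nat \<Rightarrow> complex" and Wi Ti :: "nat \<Rightarrow> complex mat"
  assumes J: "compact_embedding J"
    and m: "bilinear m" and a: "bounded_bilinear a"
    and \<phi>: "basis_family N \<phi> Vh" and \<psi>: "basis_family n \<psi> VH" and sub: "VH \<subseteq> Vh"
    and Mh: "Mh = form_mat m N \<phi>" and Kh: "Kh = form_mat a N \<phi>"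
    and MH: "MH = form_mat m n \<psi>" and KH: "KH = form_mat a n \<psi>"
    and P: "inclusion_mat P N \<phi> n \<psi>" and R: "R \<in> carrier_mat n N"
    and s: "s \<ge> 1" and A: "A \<in> carrier_mat s s" and \<Delta>t: "\<Delta>t > 0"
    and X: "X \<in> carrier_mat s s" "invertible_mat X"
    and diagonalization: "cmat A = X * mat_diag s lam * mat_inv X"
    and Bh: "Bh = stage_coupled_mat \<Delta>t A Mh Kh" "invertible_mat Bh"
    and BH: "BH = stage_coupled_mat \<Delta>t A MH KH" "invertible_mat BH"
    and Xh: "Xh = kron X (1\<^sub>m N)"
    and W: "W \<in> carrier_mat (s * N) (s * N)" "invertible_mat W" "monolithic s N Xh W"
    and Wi: "\<And>i. i < s \<Longrightarrow> Wi i \<in> carrier_mat N N" "W = Xh * block_diag s Wi * mat_inv Xh"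
    and T: "T = two_grid_mat (kron (1\<^sub>m s) (cmat P)) (kron (1\<^sub>m s) (cmat R)) (cmat BH) (cmat Bh) W \<nu>"
    and Ti: "\<And>i. i < s \<Longrightarrow> Ti i = two_grid_mat (cmat P) (cmat R)
               (single_stage_mat (lam i * of_real \<Delta>t) MH KH)
               (single_stage_mat (lam i * of_real \<Delta>t) Mh Kh) (Wi i) \<nu>"
  shows "spectral_radius T = Max ((\<lambda>i. spectral_radius (Ti i)) ` {..<s}) \<and>
    (iteration_converges T (cmat Bh) \<longleftrightarrow>
      (\<forall>i<s. iteration_converges (Ti i) (single_stage_mat (lam i * of_real \<Delta>t) Mh Kh)))"
proof -
  define bh where "bh i = single_stage_mat (lam i * of_real \<Delta>t) Mh Kh" for i
  define bH where "bH i = single_stage_mat (lam i * of_real \<Delta>t) MH KH" for i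
  let ?D = "rect_block_diag s N N" and ?XH = "kron X (1\<^sub>m n)"
  have MKh: "Mh \<in> carrier_mat N N" "Kh \<in> carrier_mat N N"
    and MKH: "MH \<in> carrier_mat n n" "KH \<in> carrier_mat n n"
    by (simp_all add: Mh Kh MH KH form_mat_def)
  have bh: "bh i \<in> carrier_mat N N" and bH: "bH i \<in> carrier_mat n n" for i
    by (simp_all add: bh_def bH_def single_stage_mat_carrier MKh MKH)
  have P: "cmat P \<in> carrier_mat N n" and R: "cmat R \<in> carrier_mat n N"
    using P R by (simp_all add: inclusion_mat_def)
  have Bh: "cmat Bh \<in> carrier_mat (s * N) (s * N)" "invertible_mat (cmat Bh)"
    "Bh = stage_coupled_mat \<Delta>t A Mh Kh"
    using Bh stage_coupled_mat_carrier[OF A MKh] invertible_cmat by auto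
  have BH: "cmat BH \<in> carrier_mat (s * n) (s * n)" "invertible_mat (cmat BH)"
    "BH = stage_coupled_mat \<Delta>t A MH KH"
    using BH stage_coupled_mat_carrier[OF A MKH] invertible_cmat by auto
  have Xh: "Xh \<in> carrier_mat (s * N) (s * N)" "invertible_mat Xh" "Xh = kron X (1\<^sub>m N)"
    using X by (simp_all add: Xh kron_one_right_invertible)
  have XH: "?XH \<in> carrier_mat (s * n) (s * n)" "invertible_mat ?XH"
    using X by (simp_all add: kron_one_right_invertible)
  note Pc = kron_carrier[OF one_carrier_mat P, of s] and Rc = kron_carrier[OF one_carrier_mat R, of s]
  note Xi = mat_inv[OF X] and Xhi = mat_inv[OF Xh(1,2)]
  have L: "mat_diag s lam \<in> carrier_mat s s" by (rule mat_diag_dim)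
  have AX: "cmat A * X = X * mat_diag s lam"
    using Xi assoc_mult_mat[OF mult_carrier_mat[OF X(1) L] Xi(1) X(1)]
      right_mult_one_mat[OF mult_carrier_mat[OF X(1) L]]
    by (simp add: diagonalization)
  have eqBh: "cmat Bh * Xh = Xh * ?D bh"
    unfolding Bh(3) Xh(3) bh_def by (rule intertwine_stage_coupled_mat[OF A MKh X(1) AX])
  have eqBH: "cmat BH * ?XH = ?XH * rect_block_diag s n n bH"
    unfolding BH(3) bH_def by (rule intertwine_stage_coupled_mat[OF A MKH X(1) AX])
  have eqW: "W * Xh = Xh * ?D Wi"
    using Xhi assoc_mult_mat[OF mult_carrier_mat[OF Xh(1) rect_block_diag_carrier] Xhi(1) Xh(1)]
      right_mult_one_mat[OF mult_carrier_mat[OF Xh(1) rect_block_diag_carrier]]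
    by (simp add: Wi(2) block_diag_eq_rect_block_diag[OF Wi(1)])
  \<comment> \<open>Both products equal \<open>kron X (cmat P)\<close>; the identity inside the
    Kronecker factor has size \<open>n\<close> on the left and \<open>N\<close> on the
    right.\<close>
  have eqP: "kron (1\<^sub>m s) (cmat P) * ?XH = Xh * kron (1\<^sub>m s) (cmat P)"
    unfolding Xh(3) using kron_mult[OF one_carrier_mat P X(1) one_carrier_mat]
      kron_mult[OF X(1) one_carrier_mat one_carrier_mat P] X(1) P by simp
  have eqR: "kron (1\<^sub>m s) (cmat R) * Xh = ?XH * kron (1\<^sub>m s) (cmat R)"
    unfolding Xh(3) using kron_mult[OF one_carrier_mat R X(1) one_carrier_mat]
      kron_mult[OF X(1) one_carrier_mat one_carrier_mat R] X(1) R by simp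
  \<comment> \<open>These three facts give meaning to all stage inverses:
    \<open>mat_inv (bH i)\<close> and \<open>mat_inv (Wi i)\<close> inside \<open>Ti i\<close>, and
    \<open>mat_inv (bh i)\<close> in the limit of the single-stage iteration.\<close>
  have invDh: "invertible_mat (?D bh)"
    by (rule intertwine_invertible[OF Bh(1) rect_block_diag_carrier Xh(1) eqBh Bh(2) Xh(2)])
  have invDH: "invertible_mat (rect_block_diag s n n bH)"
    by (rule intertwine_invertible[OF BH(1) rect_block_diag_carrier XH(1) eqBH BH(2) XH(2)])
  have invDW: "invertible_mat (?D Wi)"
    by (rule intertwine_invertible[OF W(1) rect_block_diag_carrier Xh(1) eqW W(2) Xh(2)])
  have inv: "invertible_mat (bh i)" "invertible_mat (bH i)" "invertible_mat (Wi i)" if "i < s" for i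
    using that invDh invDH invDW Wi(1) bh bH by (simp_all add: invertible_rect_block_diag_iff)
  have Tic: "Ti i \<in> carrier_mat N N" if "i < s" for i
    unfolding Ti[OF that] using that bh inv Wi(1) P R
    by (intro two_grid_mat_carrier) (auto simp: bh_def)
  have Tc: "T \<in> carrier_mat (s * N) (s * N)"
    unfolding T by (rule two_grid_mat_carrier[OF Bh(1) W(1,2) Pc Rc])
  have "T * Xh = Xh * two_grid_mat (kron (1\<^sub>m s) (cmat P)) (kron (1\<^sub>m s) (cmat R))
      (rect_block_diag s n n bH) (?D bh) (?D Wi) \<nu>"
    unfolding T
    by (rule intertwine_two_grid_mat[OF Bh(1) rect_block_diag_carrier BH(1) rect_block_diag_carrier
          BH(2) invDH W(1) rect_block_diag_carrier W(2) invDW Pc Pc Rc Rc Xh(1) XH(1)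
          eqBh eqBH eqW eqP eqR])
  also have "two_grid_mat (kron (1\<^sub>m s) (cmat P)) (kron (1\<^sub>m s) (cmat R))
      (rect_block_diag s n n bH) (?D bh) (?D Wi) \<nu>
    = ?D (\<lambda>i. two_grid_mat (cmat P) (cmat R) (bH i) (bh i) (Wi i) \<nu>)"
    unfolding kron_one_left[OF P] kron_one_left[OF R]
    using bh bH Wi(1) inv P R by (intro two_grid_mat_rect_block_diag) auto
  also have "\<dots> = ?D Ti"
    by (rule rect_block_diag_cong) (simp add: Ti bh_def bH_def)
  finally have TX: "T * Xh = Xh * ?D Ti" .
  have "similar_mat T (?D Ti)"
  proof (rule similar_matI[OF _ Xhi(2,3)])
    show "{T, ?D Ti, Xh, mat_inv Xh} \<subseteq> carrier_mat (s * N) (s * N)"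
      using Tc Xh(1) Xhi(1) by simp
    have "T = (T * Xh) * mat_inv Xh"
      using Tc Xh(1) Xhi assoc_mult_mat[OF Tc Xh(1) Xhi(1)] by simp
    then show "T = Xh * ?D Ti * mat_inv Xh" by (simp add: TX)
  qed
  then have "spectral_radius T = Max ((\<lambda>i. spectral_radius (Ti i)) ` {..<s})"
    and "powers_vanish T \<longleftrightarrow> (\<forall>i<s. powers_vanish (Ti i))"
    using spectral_radius_similar spectral_radius_rect_block_diag[OF Tic s]
      powers_vanish_similar powers_vanish_rect_block_diag[OF Tic] by auto
  \<comment> \<open>The coupled system and the stage systems have different matrices and solutions;
    both sides are therefore reduced to powers of the iteration matrices, where the equivalence is
    already known.\<close>
  moreover have "iteration_converges T (cmat Bh) \<longleftrightarrow> powers_vanish T"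
    by (rule iteration_converges_iff_powers_vanish[OF Tc Bh(1,2)])
  moreover have "iteration_converges (Ti i) (bh i) \<longleftrightarrow> powers_vanish (Ti i)" if "i < s" for i
    by (rule iteration_converges_iff_powers_vanish[OF Tic[OF that] bh inv(1)[OF that]])
  ultimately show ?thesis by (simp add: bh_def)
qed

end
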